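(* Let $n>3$ be odd and $m<n$ a positive integer with $\gcd(m,n)=\gcd(m-1,n)=1$. Let $p$ be a prime and write $n+1=p^k r$ with $k\ge 1$ and $\gcd(p,r)=1$. Then there exists a $p$-Sylow neutrosophic subloop of $\langle L_n(m)\cup I\rangle$ of order $2p^k$ if and only if $p^k-1$ divides $r-1$.
   Context: For $n>3$ odd and $m<n$ a positive integer with $\gcd(m,n)=\gcd(m-1,n)=1$, the loop $L_n(m)$ is the set $\{e,1,2,\dots,n\}$ with operation: $e\cdot i=i\cdot e=i$ for all $i$; $i\cdot i=e$ for all $i$; and for $i,j\in\{1,\dots,n\}$, $i\neq j$, $i\cdot j$ is the element $s\in\{1,\dots,n\}$ with $s\equiv mj-(m-1)i \pmod n$. The neutrosophic loop $\langle L_n(m)\cup I\rangle$ is the set $\{e,1,\dots,n,eI,1I,\dots,nI\}$ of $2(n+1)$ distinct symbols, with the product of $L_n(m)$ on $\{e,1,\dots,n\}$ and $x\cdot(yI)=(xI)\cdot y=(xI)\cdot(yI)=(x\cdot y)I$ for $x,y\in L_n(m)$. A neutrosophic subloop is a subset of the form $P\cup\{xI:x\in P\}$, where $P$ is a subloop of $L_n(m)$; the whole $\langle L_n(m)\cup I\rangle$ is allowed. The order is the number of elements. Here, for a prime $p$ with $n+1=p^kr$, $k\ge1$, $\gcd(p,r)=1$, a "$p$-Sylow neutrosophic subloop" means a neutrosophic subloop of order $2p^k$. *)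

theory Defs
  imports "HOL-Algebra.Coset" "HOL-Number_Theory.Cong"
begin

text \<open>Loops in the sense of quasigroups with a two-sided identity, no associativity, on the
  record type of \<^theory>\<open>HOL-Algebra.Group\<close>.\<close>

locale loop =
  fixes L (structure)
  assumes m_closed: "x \<in> carrier L \<Longrightarrow> y \<in> carrier L \<Longrightarrow> x \<otimes> y \<in> carrier L"
    and one_closed: "\<one> \<in> carrier L"
    and l_one: "x \<in> carrier L \<Longrightarrow> \<one> \<otimes> x = x"
    and r_one: "x \<in> carrier L \<Longrightarrow> x \<otimes> \<one> = x"
    and l_div: "a \<in> carrier L \<Longrightarrow> b \<in> carrier L \<Longrightarrow> \<exists>!x. x \<in> carrier L \<and> a \<otimes> x = b"
    and r_div: "a \<in> carrier L \<Longrightarrow> b \<in> carrier L \<Longrightarrow> \<exists>!x. x \<in> carrier L \<and> x \<otimes> a = b"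

definition subloop :: "'a set \<Rightarrow> ('a, 'b) monoid_scheme \<Rightarrow> bool" where
  "subloop P L \<longleftrightarrow> P \<subseteq> carrier L \<and> loop (L\<lparr>carrier := P\<rparr>)"

datatype symb = E | Num nat

fun loopL_mult :: "nat \<Rightarrow> nat \<Rightarrow> symb \<Rightarrow> symb \<Rightarrow> symb" where
  "loopL_mult n m E x = x"
| "loopL_mult n m (Num i) E = Num i"
| "loopL_mult n m (Num i) (Num j) =
     (if i = j then E
      else Num (THE s. s \<in> {1..n} \<and> [int s = int m * int j - (int m - 1) * int i] (mod int n)))"

definition loopL :: "nat \<Rightarrow> nat \<Rightarrow> symb monoid" where
  "loopL n m = \<lparr>carrier = insert E (Num ` {1..n}), monoid.mult = loopL_mult n m, one = E\<rparr>"

text \<open>The description in \<^const>\<open>loopL_mult\<close> is well defined.\<close>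

lemma ex1_representative:
  fixes z :: int
  assumes "n > 0"
  shows "\<exists>!s. s \<in> {1..n} \<and> [int s = z] (mod int n)"
proof -
  define s where "s = nat ((z - 1) mod int n) + 1"
  have b: "0 \<le> (z - 1) mod int n" "(z - 1) mod int n < int n"
    using assms by simp_all
  have s: "s \<in> {1..n}" using b by (auto simp: s_def)
  have "int s = (z - 1) mod int n + 1" using b by (simp add: s_def)
  then have c: "[int s = z] (mod int n)" by (simp add: cong_def mod_simps)
  have "t = s" if t: "t \<in> {1..n}" "[int t = z] (mod int n)" for t
  proof -
    have "[int t = int s] (mod int n)" using t(2) c cong_sym cong_trans by blast
    then have d: "int n dvd int t - int s" by (simp add: cong_iff_dvd_diff)
    have "\<bar>int t - int s\<bar> < int n" using t(1) s by auto
    then show "t = s" using d zdvd_not_zless[of "\<bar>int t - int s\<bar>" "int n"] by force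
  qed
  then show ?thesis using s c by blast
qed

text \<open>The element \<open>Ind x\<close> is the formal symbol \<open>xI\<close>, with \<open>I\<close> the indeterminate.\<close>

datatype 'a neutro = Plain 'a | Ind 'a

fun neutro_mult :: "('a \<Rightarrow> 'a \<Rightarrow> 'a) \<Rightarrow> 'a neutro \<Rightarrow> 'a neutro \<Rightarrow> 'a neutro" where
  "neutro_mult f (Plain x) (Plain y) = Plain (f x y)"
| "neutro_mult f (Plain x) (Ind y) = Ind (f x y)"
| "neutro_mult f (Ind x) (Plain y) = Ind (f x y)"
| "neutro_mult f (Ind x) (Ind y) = Ind (f x y)"

definition neutrosophic_loop :: "('a, 'b) monoid_scheme \<Rightarrow> 'a neutro monoid" where
  "neutrosophic_loop L =
     \<lparr>carrier = Plain ` carrier L \<union> Ind ` carrier L,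
      monoid.mult = neutro_mult (monoid.mult L), one = Plain \<one>\<^bsub>L\<^esub>\<rparr>"

definition neutrosophic_subloop :: "'a neutro set \<Rightarrow> ('a, 'b) monoid_scheme \<Rightarrow> bool" where
  "neutrosophic_subloop Q L \<longleftrightarrow>
     Q \<subseteq> carrier (neutrosophic_loop L) \<and> (\<exists>P. subloop P L \<and> Q = Plain ` P \<union> Ind ` P)"

lemma neutrosophic_subloop_closed:
  assumes "neutrosophic_subloop Q L" "x \<in> Q" "y \<in> Q"
  shows "x \<otimes>\<^bsub>neutrosophic_loop L\<^esub> y \<in> Q"
proof -
  obtain P where P: "loop (L\<lparr>carrier := P\<rparr>)" "Q = Plain ` P \<union> Ind ` P"
    using assms(1) by (auto simp: neutrosophic_subloop_def subloop_def)
  have "a \<otimes>\<^bsub>L\<^esub> b \<in> P" if "a \<in> P" "b \<in> P" for a b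
    using loop.m_closed[OF P(1)] that by simp
  then show ?thesis
    using assms(2,3) by (auto simp: P(2) neutrosophic_loop_def)
qed

text \<open>The prime power is the full power of \<open>p\<close> in the order of \<open>L\<close>, not in the order
  \<open>2 * order L\<close> of the neutrosophic loop; the two differ for \<open>p = 2\<close>.\<close>

definition sylow_neutrosophic_subloop ::
    "nat \<Rightarrow> 'a neutro set \<Rightarrow> ('a, 'b) monoid_scheme \<Rightarrow> bool" where
  "sylow_neutrosophic_subloop p Q L \<longleftrightarrow>
     prime p \<and> neutrosophic_subloop Q L \<and>
     (\<exists>k r. order L = p ^ k * r \<and> k \<ge> 1 \<and> coprime p r \<and> card Q = 2 * p ^ k)"

end

theory Submission
  imports Defs "HOL-Algebra.Elementary_Groups"
begin

text \<open>
  Away from \<open>e\<close>, the loop \<open>L\<^sub>n(m)\<close> is the quasigroup \<open>i \<bullet> j = m j - (m - 1) i\<close> on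
  the residues mod \<open>n\<close>, whose diagonal \<open>i \<bullet> i = i\<close> has been replaced by \<open>e\<close>. So the
  subloops of order \<open>t + 1\<close> are the sets \<open>insert e A\<close>, where \<open>A\<close> has \<open>t\<close> elements and is closed
  under \<open>\<bullet>\<close> (\<open>subloop_iff\<close>). The proof rests on the claim that such an \<open>A\<close>, if not empty, is
  a coset of a subgroup of \<open>\<int>/n\<close>.

  To see this, translate \<open>A\<close> to contain \<open>0\<close>, which is harmless because the coefficients \<open>m\<close> and
  \<open>1 - m\<close> sum to \<open>1\<close>. Products with the factor \<open>0\<close> show that \<open>A\<close> is mapped into itself by
  multiplication with \<open>m\<close> and with \<open>1 - m\<close>. Both are units mod \<open>n\<close> and \<open>A\<close> is finite, so both
  maps permute \<open>A\<close>. Hence any \<open>x, y \<in> A\<close> can be written \<open>x = (1 - m) x'\<close> and \<open>y = m y'\<close> with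
  \<open>x', y' \<in> A\<close>, and \<open>x + y = x' \<bullet> y' \<in> A\<close>. By Lagrange \<open>t\<close> divides \<open>n\<close>
  (\<open>prod_closed_card_dvd\<close>). Conversely, if \<open>n = d t\<close> then the multiples of \<open>d\<close> are closed under
  \<open>\<bullet>\<close> and there are \<open>t\<close> of them. So a subloop of order \<open>t + 1\<close> exists iff \<open>t\<close> divides \<open>n\<close>
  (\<open>subloop_order_iff\<close>).

  The neutrosophic statement is the case \<open>t = p\<^sup>k - 1\<close>, since \<open>n = p\<^sup>k r - 1 = t r + (r - 1)\<close>.
\<close>

section \<open>Representatives of residues\<close>

definition residue_prod :: "nat \<Rightarrow> nat \<Rightarrow> nat \<Rightarrow> nat \<Rightarrow> nat" where
  "residue_prod n m i j =
     (THE s. s \<in> {1..n} \<and> [int s = int m * int j - (int m - 1) * int i] (mod int n))"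

lemma residue_prod:
  assumes "n > 0"
  shows "residue_prod n m i j \<in> {1..n}"
    and "[int (residue_prod n m i j) = int m * int j - (int m - 1) * int i] (mod int n)"
  using theI'[OF ex1_representative[OF assms, of "int m * int j - (int m - 1) * int i"]]
  unfolding residue_prod_def by auto

text \<open>Replaces the defining equation for two numbers, so that later proofs can rely on the
  characteristic properties of the representative rather than on its description.\<close>

lemma loopL_mult_Num:
  "loopL_mult n m (Num i) (Num j) = (if i = j then E else Num (residue_prod n m i j))"
  by (simp add: residue_prod_def)

lemma cong_representatives_eq:
  assumes "i \<in> {1..n}" "j \<in> {1..n}" "[int i = int j] (mod int n)"
  shows "i = j"
  using ex1_representative[of n "int j"] assms by auto

lemma card_multiples:
  fixes d t :: nat
  assumes "d > 0"
  shows "card {i \<in> {1..d * t}. d dvd i} = t"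
proof -
  have "{i \<in> {1..d * t}. d dvd i} = (\<lambda>i. d * i) ` {1..t}"
    using assms by (auto elim!: dvdE)
  moreover have "inj_on (\<lambda>i. d * i) {1..t}" using assms by (simp add: inj_on_def)
  ultimately show ?thesis by (simp add: card_image)
qed

section \<open>Finite loops\<close>

text \<open>On a finite set an injective translation is surjective, so cancellation alone gives
  the unique solvability of both kinds of equations.\<close>

lemma loopI_finite:
  fixes L (structure)
  assumes fin: "finite (carrier L)"
    and closed: "\<And>x y. x \<in> carrier L \<Longrightarrow> y \<in> carrier L \<Longrightarrow> x \<otimes> y \<in> carrier L"
    and one: "\<one> \<in> carrier L"
    and l_one: "\<And>x. x \<in> carrier L \<Longrightarrow> \<one> \<otimes> x = x"
    and r_one: "\<And>x. x \<in> carrier L \<Longrightarrow> x \<otimes> \<one> = x"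
    and l_cancel: "\<And>a. a \<in> carrier L \<Longrightarrow> inj_on (\<lambda>x. a \<otimes> x) (carrier L)"
    and r_cancel: "\<And>a. a \<in> carrier L \<Longrightarrow> inj_on (\<lambda>x. x \<otimes> a) (carrier L)"
  shows "loop L"
proof (rule loop.intro)
  fix a b assume a: "a \<in> carrier L" and b: "b \<in> carrier L"
  have "(\<lambda>x. a \<otimes> x) ` carrier L = carrier L"
    by (rule endo_inj_surj[OF fin _ l_cancel[OF a]]) (auto intro: closed a)
  with b have "b \<in> (\<lambda>x. a \<otimes> x) ` carrier L" by (simp only:)
  then obtain x where "x \<in> carrier L" "b = a \<otimes> x" by (rule imageE)
  then show "\<exists>!x. x \<in> carrier L \<and> a \<otimes> x = b"
    using inj_onD[OF l_cancel[OF a]] by blast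
  have "(\<lambda>x. x \<otimes> a) ` carrier L = carrier L"
    by (rule endo_inj_surj[OF fin _ r_cancel[OF a]]) (auto intro: closed a)
  with b have "b \<in> (\<lambda>x. x \<otimes> a) ` carrier L" by (simp only:)
  then obtain y where "y \<in> carrier L" "b = y \<otimes> a" by (rule imageE)
  then show "\<exists>!x. x \<in> carrier L \<and> x \<otimes> a = b"
    using inj_onD[OF r_cancel[OF a]] by blast
qed (fact closed one l_one r_one)+

section \<open>The quasigroup on the residues\<close>

text \<open>The two coprimality conditions say exactly that \<open>m j - (m - 1) i\<close> can be solved mod \<open>n\<close> for
  \<open>j\<close> and for \<open>i\<close>.\<close>

locale residue_loop =
  fixes n m :: nat
  assumes n_pos: "n > 0"
    and coprime_m: "coprime (int m) (int n)"
    and coprime_m1: "coprime (int m - 1) (int n)"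
begin

abbreviation dot (infixl "\<bullet>" 70) where "i \<bullet> j \<equiv> residue_prod n m i j"

lemmas prod_in = residue_prod(1)[OF n_pos, of m]
lemmas prod_cong = residue_prod(2)[OF n_pos, of m]

lemma prod_eq_iff:
  "i \<bullet> j = i' \<bullet> j' \<longleftrightarrow>
   int n dvd int m * (int j - int j') - (int m - 1) * (int i - int i')" (is "_ \<longleftrightarrow> int n dvd ?d")
proof -
  have "i \<bullet> j = i' \<bullet> j' \<longleftrightarrow> [int (i \<bullet> j) = int (i' \<bullet> j')] (mod int n)"
    using cong_representatives_eq[OF prod_in prod_in] cong_refl by metis
  also have "\<dots> \<longleftrightarrow> [int m * int j - (int m - 1) * int i
      = int m * int j' - (int m - 1) * int i'] (mod int n)"
    using prod_cong[of i j] prod_cong[of i' j'] unfolding cong_def by simp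
  also have "\<dots> \<longleftrightarrow> int n dvd ?d"
    by (simp add: cong_iff_dvd_diff algebra_simps)
  finally show ?thesis .
qed

lemma dvd_diff_imp_eq:
  assumes "i \<in> {1..n}" "j \<in> {1..n}" "int n dvd int i - int j"
  shows "i = j"
  using cong_representatives_eq[OF assms(1,2)] assms(3) by (simp add: cong_iff_dvd_diff)

lemma dvd_cancel:
  "int n dvd int m * x \<longleftrightarrow> int n dvd x"
  "int n dvd (int m - 1) * x \<longleftrightarrow> int n dvd x"
  using coprime_m coprime_m1 by (simp_all only: coprime_dvd_mult_right_iff coprime_commute[of "int n"])

lemma prod_idem: "i \<in> {1..n} \<Longrightarrow> i \<bullet> i = i"
proof -
  assume i: "i \<in> {1..n}"
  have "[int (i \<bullet> i) = int i] (mod int n)"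
    using prod_cong[of i i] by (simp add: algebra_simps)
  then show ?thesis by (rule cong_representatives_eq[OF prod_in i])
qed

lemma prod_left_cancel:
  assumes "j \<in> {1..n}" "j' \<in> {1..n}" "i \<bullet> j = i \<bullet> j'"
  shows "j = j'"
  using assms(3) dvd_diff_imp_eq[OF assms(1,2)] unfolding prod_eq_iff by (simp add: dvd_cancel)

lemma prod_right_cancel:
  assumes "i \<in> {1..n}" "i' \<in> {1..n}" "i \<bullet> j = i' \<bullet> j"
  shows "i = i'"
  using assms(3) dvd_diff_imp_eq[OF assms(1,2)] unfolding prod_eq_iff by (simp add: dvd_cancel)

text \<open>Off the diagonal a product differs from both factors. This keeps the identity \<open>e\<close> from
  clashing with the cancellation laws: \<open>i \<cdot> e = i\<close> is never repeated as \<open>i \<cdot> j\<close> with \<open>j \<noteq> i\<close>.\<close>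

lemma prod_eq_factor:
  assumes "i \<in> {1..n}" "j \<in> {1..n}" "i \<bullet> j = i \<or> i \<bullet> j = j"
  shows "i = j"
  using assms prod_idem prod_left_cancel prod_right_cancel by metis

lemma loopL_mult_left_cancel:
  assumes "a \<in> carrier (loopL n m)" "x \<in> carrier (loopL n m)" "y \<in> carrier (loopL n m)"
    and "loopL_mult n m a x = loopL_mult n m a y"
  shows "x = y"
proof (cases a)
  case E
  then show ?thesis using assms(4) by (cases x; cases y) auto
next
  case (Num i)
  have factor: "i \<bullet> j \<noteq> i" "i \<noteq> i \<bullet> j" if "j \<in> {1..n}" "i \<noteq> j" for j
    using that assms(1) prod_eq_factor[of i j] Num by (auto simp: loopL_def)
  show ?thesis
  proof (cases x; cases y)
    fix j j' assume xy: "x = Num j" "y = Num j'"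
    then have "j \<in> {1..n}" "j' \<in> {1..n}" using assms(2,3) by (auto simp: loopL_def)
    then show "x = y"
      using assms(4) xy Num prod_left_cancel[of j j' i]
      by (simp add: loopL_mult_Num del: loopL_mult.simps(3) split: if_splits)
  qed (use assms(2-4) Num factor in
    \<open>auto simp: loopL_def loopL_mult_Num simp del: loopL_mult.simps(3) split: if_splits\<close>)
qed

lemma loopL_mult_right_cancel:
  assumes "a \<in> carrier (loopL n m)" "x \<in> carrier (loopL n m)" "y \<in> carrier (loopL n m)"
    and "loopL_mult n m x a = loopL_mult n m y a"
  shows "x = y"
proof (cases a)
  case E
  then show ?thesis using assms(4) by (cases x; cases y) auto
next
  case (Num i)
  have factor: "j \<bullet> i \<noteq> i" "i \<noteq> j \<bullet> i" if "j \<in> {1..n}" "i \<noteq> j" for j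
    using that assms(1) prod_eq_factor[of j i] Num by (auto simp: loopL_def)
  show ?thesis
  proof (cases x; cases y)
    fix j j' assume xy: "x = Num j" "y = Num j'"
    then have "j \<in> {1..n}" "j' \<in> {1..n}" using assms(2,3) by (auto simp: loopL_def)
    then show "x = y"
      using assms(4) xy Num prod_right_cancel[of j j' i]
      by (simp add: loopL_mult_Num del: loopL_mult.simps(3) split: if_splits)
  qed (use assms(2-4) Num factor in
    \<open>auto simp: loopL_def loopL_mult_Num simp del: loopL_mult.simps(3) split: if_splits\<close>)
qed

section \<open>Orders of subloops\<close>

text \<open>The diagonal of the loop carries \<open>e\<close> and that of \<open>\<bullet>\<close> carries \<open>i \<bullet> i = i\<close>. Neither leaves the
  set, so closure in the loop and closure under \<open>\<bullet>\<close> agree; cancellation is inherited from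
  the whole loop.\<close>

lemma subloop_iff:
  assumes A: "A \<subseteq> {1..n}"
  shows "subloop (insert E (Num ` A)) (loopL n m) \<longleftrightarrow> (\<forall>i\<in>A. \<forall>j\<in>A. i \<bullet> j \<in> A)"
proof
  assume "subloop (insert E (Num ` A)) (loopL n m)"
  then have L: "loop (loopL n m\<lparr>carrier := insert E (Num ` A)\<rparr>)"
    by (simp add: subloop_def)
  show "\<forall>i\<in>A. \<forall>j\<in>A. i \<bullet> j \<in> A"
  proof (intro ballI)
    fix i j assume ij: "i \<in> A" "j \<in> A"
    show "i \<bullet> j \<in> A"
    proof (cases "i = j")
      case True
      then show ?thesis using ij A prod_idem by auto
    next
      case False
      then show ?thesis
        using loop.m_closed[OF L, of "Num i" "Num j"] ij
        by (auto simp: loopL_def loopL_mult_Num simp del: loopL_mult.simps(3))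
    qed
  qed
next
  assume closed: "\<forall>i\<in>A. \<forall>j\<in>A. i \<bullet> j \<in> A"
  let ?P = "insert E (Num ` A)"
  have P: "?P \<subseteq> carrier (loopL n m)" using A by (auto simp: loopL_def)
  have rec: "carrier (loopL n m\<lparr>carrier := ?P\<rparr>) = ?P"
    "monoid.mult (loopL n m\<lparr>carrier := ?P\<rparr>) = loopL_mult n m"
    "\<one>\<^bsub>loopL n m\<lparr>carrier := ?P\<rparr>\<^esub> = E"
    by (simp_all add: loopL_def)
  have "loop (loopL n m\<lparr>carrier := ?P\<rparr>)"
  proof (rule loopI_finite)
    show "finite (carrier (loopL n m\<lparr>carrier := ?P\<rparr>))"
      using A finite_subset by fastforce
  next
    fix a assume "a \<in> carrier (loopL n m\<lparr>carrier := ?P\<rparr>)"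
    then have a: "a \<in> ?P" by simp
    show "inj_on (\<lambda>x. a \<otimes>\<^bsub>loopL n m\<lparr>carrier := ?P\<rparr>\<^esub> x)
        (carrier (loopL n m\<lparr>carrier := ?P\<rparr>))"
      using loopL_mult_left_cancel[OF subsetD[OF P a] subsetD[OF P] subsetD[OF P]]
      unfolding inj_on_def rec by blast
    show "inj_on (\<lambda>x. x \<otimes>\<^bsub>loopL n m\<lparr>carrier := ?P\<rparr>\<^esub> a)
        (carrier (loopL n m\<lparr>carrier := ?P\<rparr>))"
      using loopL_mult_right_cancel[OF subsetD[OF P a] subsetD[OF P] subsetD[OF P]]
      unfolding inj_on_def rec by blast
  qed (use closed in \<open>auto simp: rec loopL_mult_Num simp del: loopL_mult.simps(3) split: if_split_asm\<close>)
  then show "subloop ?P (loopL n m)" using P by (simp add: subloop_def)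
qed

text \<open>The translate \<open>C\<close> of \<open>A\<close> by one of its elements is a subgroup of \<open>\<int>/n\<close>. Addition is
  recovered from \<open>\<bullet>\<close> because multiplication by \<open>m\<close> and by \<open>1 - m\<close> permutes \<open>C\<close>.\<close>

lemma prod_closed_card_dvd:
  assumes A: "A \<subseteq> {1..n}" "A \<noteq> {}" and closed: "\<And>i j. i \<in> A \<Longrightarrow> j \<in> A \<Longrightarrow> i \<bullet> j \<in> A"
  shows "card A dvd n"
proof -
  let ?N = "int n" and ?G = "integer_mod_group n"
  have carrier: "carrier ?G = {0..<?N}"
    using n_pos by (auto simp: carrier_integer_mod_group)
  interpret group ?G by (rule group_integer_mod_group)
  obtain a where a: "a \<in> A" using A(2) by blast
  define C where "C = (\<lambda>i. (int i - int a) mod ?N) ` A"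
  have fin: "finite C" unfolding C_def using A(1) finite_subset by blast
  have C_sub: "C \<subseteq> {0..<?N}" using n_pos by (auto simp: C_def)
  have zero: "0 \<in> C" unfolding C_def using a by force
  have affine: "(int m * y - (int m - 1) * x) mod ?N \<in> C" if x: "x \<in> C" and y: "y \<in> C" for x y
  proof -
    obtain i j where ij: "i \<in> A" "j \<in> A"
      and xy: "x = (int i - int a) mod ?N" "y = (int j - int a) mod ?N"
      using x y by (auto simp: C_def)
    have "(int (i \<bullet> j) - int a) mod ?N = (int m * int j - (int m - 1) * int i - int a) mod ?N"
      using prod_cong[of i j] by (metis cong_def mod_diff_left_eq)
    also have "\<dots> = (int m * (int j - int a) - (int m - 1) * (int i - int a)) mod ?N"
      by (simp add: algebra_simps)
    also have "\<dots> = (int m * y - (int m - 1) * x) mod ?N"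
      unfolding xy cong_def[symmetric] by (intro cong_diff cong_mult) (simp_all add: cong_def)
    finally show ?thesis using closed[OF ij] unfolding C_def by (metis image_eqI)
  qed
  have surj: "(\<lambda>x. (u * x) mod ?N) ` C = C"
    if u: "coprime u ?N" and sub: "(\<lambda>x. (u * x) mod ?N) ` C \<subseteq> C" for u
  proof (rule endo_inj_surj[OF fin sub], rule inj_onI)
    fix x y assume xy: "x \<in> C" "y \<in> C" "(u * x) mod ?N = (u * y) mod ?N"
    then have "[x = y] (mod ?N)"
      using u by (metis cong_def cong_mult_lcancel coprime_commute)
    then show "x = y" using xy(1,2) C_sub by (auto simp: cong_def subset_iff)
  qed
  have m_surj: "(\<lambda>x. (int m * x) mod ?N) ` C = C"
    by (rule surj[OF coprime_m]) (use affine[OF zero] in auto)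
  have m1_surj: "(\<lambda>x. ((1 - int m) * x) mod ?N) ` C = C"
  proof (rule surj)
    show "coprime (1 - int m) ?N"
      using coprime_m1 by (metis coprime_minus_left_iff minus_diff_eq)
    show "(\<lambda>x. ((1 - int m) * x) mod ?N) ` C \<subseteq> C"
      using affine[OF _ zero] by (auto simp: algebra_simps)
  qed
  have add: "(x + y) mod ?N \<in> C" if x: "x \<in> C" and y: "y \<in> C" for x y
  proof -
    have "x \<in> (\<lambda>x. ((1 - int m) * x) mod ?N) ` C" by (simp only: m1_surj x)
    then obtain x' where x': "x' \<in> C" "x = ((1 - int m) * x') mod ?N" by (rule imageE)
    have "y \<in> (\<lambda>x. (int m * x) mod ?N) ` C" by (simp only: m_surj y)
    then obtain y' where y': "y' \<in> C" "y = (int m * y') mod ?N" by (rule imageE)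
    have "(x + y) mod ?N = ((1 - int m) * x' + int m * y') mod ?N"
      unfolding x'(2) y'(2) by (rule mod_add_eq)
    moreover have "(1 - int m) * x' + int m * y' = int m * y' - (int m - 1) * x'"
      by (simp only: left_diff_distrib)
    ultimately have "(x + y) mod ?N = (int m * y' - (int m - 1) * x') mod ?N" by (simp only:)
    then show ?thesis using affine[OF x'(1) y'(1)] by simp
  qed
  \<comment> \<open>Closure under negation follows by finiteness: adding \<open>x\<close> permutes \<open>C\<close>, so it reaches \<open>0\<close>.\<close>
  have neg: "(- x) mod ?N \<in> C" if x: "x \<in> C" for x
  proof -
    have "(\<lambda>y. (x + y) mod ?N) ` C = C"
    proof (rule endo_inj_surj[OF fin], use add[OF x] in blast, rule inj_onI)
      fix y z assume yz: "y \<in> C" "z \<in> C" "(x + y) mod ?N = (x + z) mod ?N"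
      then have "[y = z] (mod ?N)" by (metis cong_add_lcancel cong_def)
      then show "y = z" using yz(1,2) C_sub by (auto simp: cong_def subset_iff)
    qed
    then have "0 \<in> (\<lambda>y. (x + y) mod ?N) ` C" by (simp only: zero)
    then obtain y where y: "y \<in> C" "0 = (x + y) mod ?N" by (rule imageE)
    from y(2)[symmetric] have "?N dvd - (- x - y)" by (simp add: mod_eq_0_iff_dvd add.commute)
    then have "[- x = y] (mod ?N)" unfolding cong_iff_dvd_diff by (simp only: dvd_minus_iff)
    then show ?thesis using y(1) C_sub by (auto simp: cong_def subset_iff)
  qed
  have "subgroup C ?G"
  proof (rule subgroupI)
    fix x assume "x \<in> C"
    then show "inv\<^bsub>?G\<^esub> x \<in> C"
      using neg[of x] C_sub by (simp add: inv_integer_mod_group carrier subset_iff)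
  qed (use C_sub zero add in \<open>auto simp: carrier mult_integer_mod_group\<close>)
  then have "card C dvd order ?G" using lagrange by (metis dvd_triv_right)
  moreover have "card C = card A"
    unfolding C_def
  proof (rule card_image, rule inj_onI)
    fix i j assume ij: "i \<in> A" "j \<in> A" "(int i - int a) mod ?N = (int j - int a) mod ?N"
    then have "?N dvd int i - int j" by (simp add: mod_eq_dvd_iff)
    then show "i = j" using ij A dvd_diff_imp_eq by blast
  qed
  moreover have "order ?G = n" by (simp add: order_def carrier)
  ultimately show ?thesis by simp
qed

text \<open>As \<open>d\<close> divides \<open>n\<close>, divisibility by \<open>d\<close> does not depend on the representative mod \<open>n\<close>.\<close>

lemma prod_closed_multiples:
  assumes "d dvd n" "d dvd i" "d dvd j"
  shows "d dvd i \<bullet> j"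
proof -
  have "int d dvd int m * int j - (int m - 1) * int i" using assms by simp
  moreover have "[int (i \<bullet> j) = int m * int j - (int m - 1) * int i] (mod int d)"
    using prod_cong assms(1) by (meson cong_dvd_modulus int_dvd_int_iff)
  ultimately show ?thesis by (metis cong_dvd_iff int_dvd_int_iff)
qed

theorem subloop_order_iff:
  assumes "t > 0"
  shows "(\<exists>P. subloop P (loopL n m) \<and> card P = t + 1) \<longleftrightarrow> t dvd n"
proof
  assume "\<exists>P. subloop P (loopL n m) \<and> card P = t + 1"
  then obtain P where P: "subloop P (loopL n m)" "card P = t + 1" by blast
  define A where "A = {i. Num i \<in> P}"
  have "E \<in> P" using P(1) loop.one_closed by (fastforce simp: subloop_def loopL_def)
  then have P_eq: "P = insert E (Num ` A)"
    unfolding A_def using symb.exhaust by (auto simp: image_iff)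
  have A: "A \<subseteq> {1..n}" using P(1) by (auto simp: A_def subloop_def loopL_def)
  have "card (Num ` A) = card A" by (simp add: card_image inj_on_def)
  then have "card A = t" using P(2) A finite_subset[OF A] unfolding P_eq
    by (subst (asm) card_insert_disjoint) auto
  moreover have "card A dvd n"
    using prod_closed_card_dvd[OF A] subloop_iff[OF A] P(1) P_eq assms calculation by fastforce
  ultimately show "t dvd n" by simp
next
  assume "t dvd n"
  then obtain d where d: "n = d * t" by (metis dvd_def mult.commute)
  define A where "A = {i \<in> {1..n}. d dvd i}"
  have A: "A \<subseteq> {1..n}" by (auto simp: A_def)
  have "subloop (insert E (Num ` A)) (loopL n m)"
    using subloop_iff[OF A] prod_closed_multiples prod_in d unfolding A_def by simp
  moreover have "card A = t"
    unfolding A_def d using card_multiples[of d t] d n_pos by simp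
  then have "card (insert E (Num ` A)) = t + 1"
    using finite_subset[OF A] by (subst card_insert_disjoint) (auto simp: card_image inj_on_def)
  ultimately show "\<exists>P. subloop P (loopL n m) \<and> card P = t + 1" by blast
qed

end

section \<open>Neutrosophic subloops\<close>

lemma order_loopL: "order (loopL n m) = n + 1"
  unfolding order_def loopL_def
  by simp (subst card_insert_disjoint, auto simp: card_image inj_on_def)

lemma card_neutrosophic_set: "card (Plain ` P \<union> Ind ` P) = 2 * card P"
proof (cases "finite P")
  case True
  then have "card (Plain ` P \<union> Ind ` P) = card (Plain ` P) + card (Ind ` P)"
    by (intro card_Un_disjoint) auto
  then show ?thesis by (simp add: card_image inj_on_def)
next
  case False
  then have "infinite (Plain ` P)" by (simp add: finite_image_iff inj_on_def)
  then show ?thesis using False by simp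
qed

lemma ex_neutrosophic_subloop_card:
  "(\<exists>Q. neutrosophic_subloop Q L \<and> card Q = 2 * c) \<longleftrightarrow> (\<exists>P. subloop P L \<and> card P = c)"
proof
  assume "\<exists>Q. neutrosophic_subloop Q L \<and> card Q = 2 * c"
  then show "\<exists>P. subloop P L \<and> card P = c"
    by (auto simp: neutrosophic_subloop_def card_neutrosophic_set)
next
  assume "\<exists>P. subloop P L \<and> card P = c"
  then obtain P where P: "subloop P L" "card P = c" by blast
  have "neutrosophic_subloop (Plain ` P \<union> Ind ` P) L"
    using P(1) by (auto simp: neutrosophic_subloop_def neutrosophic_loop_def subloop_def)
  then show "\<exists>Q. neutrosophic_subloop Q L \<and> card Q = 2 * c"
    using P(2) card_neutrosophic_set by blast
qed

theorem theorem4p1p5: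
  fixes n m p k r :: nat
  assumes "n > 3" and "odd n"
    and "0 < m" and "m < n"
    and "gcd m n = 1" and "gcd (m - 1) n = 1"
    and "prime p" and "n + 1 = p ^ k * r" and "k \<ge> 1" and "gcd p r = 1"
  shows "(\<exists>Q. sylow_neutrosophic_subloop p Q (loopL n m) \<and> card Q = 2 * p ^ k)
           \<longleftrightarrow> (p ^ k - 1) dvd (r - 1)"
proof -
  have m1: "int m - 1 = int (m - 1)" using \<open>0 < m\<close> by simp
  interpret residue_loop n m
  proof
    show "coprime (int m - 1) (int n)"
      using assms(6) unfolding m1 coprime_int_iff by (simp add: coprime_iff_gcd_eq_1)
    show "coprime (int m) (int n)"
      using assms(5) unfolding coprime_int_iff by (simp add: coprime_iff_gcd_eq_1)
  qed (use assms(1) in simp)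
  define t where "t = p ^ k - 1"
  have "p ^ k > 1" using one_less_power[OF prime_gt_1_nat[OF assms(7)], of k] assms(9) by simp
  then have t: "t > 0" "p ^ k = t + 1" by (simp_all add: t_def)
  have "r > 0" using assms(8) by (cases r) auto
  \<comment> \<open>Since \<open>n + 1 = (t + 1) r\<close>, the numbers \<open>n\<close> and \<open>r - 1\<close> agree modulo \<open>t\<close>.\<close>
  then have n: "n = t * r + (r - 1)" using assms(8) t(2) by (simp add: algebra_simps)
  have "(\<exists>Q. sylow_neutrosophic_subloop p Q (loopL n m) \<and> card Q = 2 * p ^ k)
      \<longleftrightarrow> (\<exists>Q. neutrosophic_subloop Q (loopL n m) \<and> card Q = 2 * p ^ k)"
    using assms(7-10) order_loopL[of n m]
    unfolding sylow_neutrosophic_subloop_def coprime_iff_gcd_eq_1 by metis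
  also have "\<dots> \<longleftrightarrow> t dvd n"
    using ex_neutrosophic_subloop_card subloop_order_iff[OF t(1)] t(2) by metis
  also have "\<dots> \<longleftrightarrow> t dvd (r - 1)"
    by (subst n) (simp add: dvd_add_right_iff)
  finally show ?thesis by (simp add: t_def)
qed

end
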